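(* For every integer $k\ge 1$, $$\zeta(2k+1)\le\sqrt{\zeta(2k)\,\zeta(2k+2)}.$$
   Context: $\zeta(s)=\sum_{n=1}^{\infty}\frac{1}{n^s}$ denotes the Riemann zeta function, for real $s>1$. *)

theory Defs
  imports "HOL-Analysis.Analysis"
begin

(* Meaningful for s > 1, where the series converges; the index is shifted so that it starts at 1. *)
definition zeta :: "real \<Rightarrow> real" where
  "zeta s = (\<Sum>n. 1 / real (Suc n) powr s)"

end

theory Submission
  imports Defs
begin

text \<open>
  The inequality is the midpoint case of the log-convexity of \<open>\<zeta>\<close> on \<open>(1, \<infinity>)\<close>. Each term of the
  series at the exponent \<open>(s + t) / 2\<close> is the product of the square roots of the terms at \<open>s\<close>
  and \<open>t\<close>, so the Cauchy--Schwarz inequality bounds every partial sum of \<open>\<zeta> ((s + t) / 2)\<close> by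
  \<open>sqrt (\<zeta> s * \<zeta> t)\<close>. The theorem takes \<open>s = 2 * k\<close> and \<open>t = 2 * k + 2\<close>.
\<close>

lemma summable_zeta:
  fixes s :: real
  assumes "s > 1"
  shows "summable (\<lambda>n. 1 / real (Suc n) powr s)"
proof -
  have "summable (\<lambda>n. real n powr (- s))"
    using assms by (simp add: summable_real_powr_iff)
  then have "summable (\<lambda>n. real (Suc n) powr (- s))"
    by (subst summable_Suc_iff)
  then show ?thesis
    by (simp only: powr_minus_divide)
qed

text \<open>
  Cauchy--Schwarz is applied to finite sums, where no convergence question arises; the bound
  obtained is uniform in the number of terms and hence passes to the limit.
\<close>

lemma zeta_midpoint_log_convex:
  fixes s t :: real
  assumes s: "s > 1" and t: "t > 1"
  shows "zeta ((s + t) / 2) \<le> sqrt (zeta s * zeta t)"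
proof -
  have partial_le: "(\<Sum>n<N. 1 / real (Suc n) powr ((s + t) / 2)) \<le> sqrt (zeta s * zeta t)" for N
  proof (rule real_le_rsqrt)
    have split: "1 / real (Suc n) powr ((s + t) / 2)
        = (1 / real (Suc n) powr (s / 2)) * (1 / real (Suc n) powr (t / 2))" for n
      by (simp add: add_divide_distrib powr_add)
    have square: "(1 / real (Suc n) powr (u / 2))\<^sup>2 = 1 / real (Suc n) powr u" for n u
      by (simp add: power2_eq_square flip: powr_add)
    have "(\<Sum>n<N. 1 / real (Suc n) powr ((s + t) / 2))\<^sup>2
        \<le> (\<Sum>n<N. (1 / real (Suc n) powr (s / 2))\<^sup>2) * (\<Sum>n<N. (1 / real (Suc n) powr (t / 2))\<^sup>2)"
      unfolding split by (rule Cauchy_Schwarz_ineq_sum)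
    also have "\<dots> = (\<Sum>n<N. 1 / real (Suc n) powr s) * (\<Sum>n<N. 1 / real (Suc n) powr t)"
      by (simp only: square)
    also have "\<dots> \<le> zeta s * zeta t"
      unfolding zeta_def using s t
      by (intro mult_mono sum_le_suminf summable_zeta suminf_nonneg sum_nonneg) auto
    finally show "(\<Sum>n<N. 1 / real (Suc n) powr ((s + t) / 2))\<^sup>2 \<le> zeta s * zeta t" .
  qed
  have "summable (\<lambda>n. 1 / real (Suc n) powr ((s + t) / 2))"
    using s t by (intro summable_zeta) simp
  then have "(\<Sum>n. 1 / real (Suc n) powr ((s + t) / 2)) \<le> sqrt (zeta s * zeta t)"
    using partial_le by (rule suminf_le_const)
  then show ?thesis
    by (simp only: zeta_def)
qed

theorem mainTheorem2:
  fixes k :: nat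
  assumes "k \<ge> 1"
  shows "zeta (2 * real k + 1) \<le> sqrt (zeta (2 * real k) * zeta (2 * real k + 2))"
proof -
  have "2 * real k > 1" "2 * real k + 2 > 1"
    using assms by simp_all
  then have "zeta ((2 * real k + (2 * real k + 2)) / 2)
      \<le> sqrt (zeta (2 * real k) * zeta (2 * real k + 2))"
    by (rule zeta_midpoint_log_convex)
  moreover have "(2 * real k + (2 * real k + 2)) / 2 = 2 * real k + 1"
    by (simp add: field_simps)
  ultimately show ?thesis
    by (simp only:)
qed

end
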